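(* Let $\ell$ be an integer such that either $\ell \in \{10, 13, 16\}$, or $\ell \geq 19$ and $\ell$ is not divisible by $3$. Then $\gamma(C_\ell) = 1/3$.
   Context: All hypergraphs are $3$-uniform: a hypergraph $H$ consists of a vertex set $V(H)$ and an edge set $E(H)$ of $3$-element subsets of $V(H)$. For a $2$-element set $S=\{u,v\}\subseteq V(H)$, its codegree $d_H(S)$ is the number of vertices $w\in V(H)$ such that $\{u,v,w\}\in E(H)$; the minimum codegree $\delta_2(H)$ is the minimum of $d_H(S)$ over all $2$-element subsets $S$ of $V(H)$. For a hypergraph $F$ and integer $n$, the codegree Turán number $\mathrm{ex}_2(n,F)$ is the maximum $d$ such that there exists an $n$-vertex hypergraph $H$ containing no copy of $F$ with $\delta_2(H)\geq d$, and the codegree Turán density is $\gamma(F)=\lim_{n\to\infty}\mathrm{ex}_2(n,F)/n$ (this limit exists). For $\ell\geq 3$, the tight cycle $C_\ell$ is the $3$-uniform hypergraph with vertex set $\{v_1,\dots,v_\ell\}$ and edge set $\{\{v_i,v_{i+1},v_{i+2}\}: i\in \mathbb{Z}/\ell\mathbb{Z}\}$ (indices taken modulo $\ell$). *)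

theory Defs
  imports Complex_Main
begin

record 'a hypergraph =
  verts :: "'a set"
  edges :: "'a set set"

definition wf_hypergraph :: "'a hypergraph \<Rightarrow> bool" where
  "wf_hypergraph H \<longleftrightarrow> finite (verts H) \<and> (\<forall>e\<in>edges H. e \<subseteq> verts H \<and> card e = 3)"

definition codegree :: "'a hypergraph \<Rightarrow> 'a set \<Rightarrow> nat" where
  "codegree H S = card {w \<in> verts H. insert w S \<in> edges H}"

(* Only meaningful for at least two vertices; otherwise this is the unspecified value Min {}. *)
definition min_codegree :: "'a hypergraph \<Rightarrow> nat" where
  "min_codegree H = Min (codegree H ` {S. S \<subseteq> verts H \<and> card S = 2})"

(* A copy of F need not be induced. *)
definition contains_copy :: "'a hypergraph \<Rightarrow> 'b hypergraph \<Rightarrow> bool" where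
  "contains_copy H F \<longleftrightarrow>
     (\<exists>f. inj_on f (verts F) \<and> f ` verts F \<subseteq> verts H \<and> (\<forall>e\<in>edges F. f ` e \<in> edges H))"

(* All notions are invariant under isomorphism, so it suffices to let the n-vertex
   hypergraphs H range over those whose vertices are natural numbers. *)
definition codegree_turan_number :: "nat \<Rightarrow> 'b hypergraph \<Rightarrow> nat" where
  "codegree_turan_number n F =
     Max {d. \<exists>H :: nat hypergraph. wf_hypergraph H \<and> card (verts H) = n \<and>
               \<not> contains_copy H F \<and> d \<le> min_codegree H}"

definition codegree_turan_ratio :: "'b hypergraph \<Rightarrow> nat \<Rightarrow> real" where
  "codegree_turan_ratio F n = real (codegree_turan_number n F) / real n"

(* The value of lim is unspecified for a divergent sequence, so statements about this
   constant should be accompanied by convergence of the ratio. *)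
definition codegree_turan_density :: "'b hypergraph \<Rightarrow> real" where
  "codegree_turan_density F = lim (codegree_turan_ratio F)"

(* The vertices are the residues 0, ..., l - 1 modulo l; intended for l \<ge> 3. *)
definition tight_cycle :: "nat \<Rightarrow> nat hypergraph" where
  "tight_cycle l =
     \<lparr>verts = {..<l}, edges = (\<lambda>i. {i, (i + 1) mod l, (i + 2) mod l}) ` {..<l}\<rparr>"

lemma wf_tight_cycle:
  assumes "l \<ge> 3"
  shows "wf_hypergraph (tight_cycle l)"
proof -
  have "card {i, (i + 1) mod l, (i + 2) mod l} = 3" if "i < l" for i
  proof -
    consider "i + 2 < l" | "i + 2 = l" | "i + 1 = l" using \<open>i < l\<close> by linarith
    then show ?thesis
    proof cases
      case 3
      then have "(i + 2) mod l = 1" using assms by (metis add.commute add_2_eq_Suc' Suc_eq_plus1 mod_add_self2 mod_less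
          One_nat_def add_Suc_right less_le_trans numeral_3_eq_3 Suc_less_eq zero_less_Suc)
      then show ?thesis using 3 assms by (auto simp: card_insert_if)
    qed (use assms in \<open>auto simp: card_insert_if\<close>)
  qed
  then show ?thesis
    using assms by (auto simp: wf_hypergraph_def tight_cycle_def)
qed

end

theory Submission
  imports Defs "HOL-Library.FuncSet"
begin

text \<open>For the upper bound, let every pair of an \<open>m\<close>-vertex hypergraph have codegree more than
  \<open>m/3\<close>. For every edge \<open>xyz\<close> two of the neighbourhoods of \<open>xy\<close>, \<open>yz\<close>, \<open>xz\<close> meet, so the edge
  lies in a \<open>K\<^sub>4\<^sup>-\<close>, say with edges \<open>abc\<close>, \<open>abd\<close>, \<open>acd\<close> and apex \<open>a\<close>. Inside it, tight
  walks lead from \<open>ba\<close> to \<open>ab\<close> in 4 steps, from \<open>ab\<close> to \<open>ba\<close> in 5 steps and from \<open>bc\<close> to \<open>cb\<close>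
  in 6 steps. Without a closed tight walk of length 10, each pair therefore has exactly one type:
  it avoids the apex in every such \<open>K\<^sub>4\<^sup>-\<close> (base pair), or it always contains the apex and is then
  oriented towards it. Every edge consists of a base pair and two arrows to the third vertex, hence
  all vertices but at most one sink have base degree and out-degree above \<open>m/3\<close>, so in-degree
  below \<open>m/3\<close>, and the in-degrees cannot add up to the out-degrees.

  A closed tight walk of length 10 extends to lengths \<open>10a + 3b\<close>. To get an actual tight cycle in a
  large hypergraph, sample \<open>m\<close> vertices: by a Chernoff bound most samples inherit the codegree
  condition, so a positive proportion of the samples contains a closed walk on the same indices,
  and a complete \<open>m\<close>-partite family of such samples leaves room to make the walk injective.

  For the lower bound take the triples of sum 1 modulo 3.\<close>

subsection \<open>Closed tight walks of length 10\<close>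

text \<open>A tight walk is a path in this digraph on ordered pairs. For \<open>l > 0\<close>,
  \<open>(p, p) \<in> tight_step H ^^ l\<close> describes a closed tight walk, a possibly degenerate
  image of \<open>tight_cycle l\<close>.\<close>

definition tight_step :: "'a hypergraph \<Rightarrow> (('a \<times> 'a) \<times> ('a \<times> 'a)) set" where
  "tight_step H = {((u, v), (v, w)) | u v w. {u, v, w} \<in> edges H}"

lemma tight_step_iff: "((u, v), (v', w)) \<in> tight_step H \<longleftrightarrow> v' = v \<and> {u, v, w} \<in> edges H"
  by (auto simp: tight_step_def)

lemma wf_hypergraph_edgeD:
  assumes "wf_hypergraph H" "{u, v, w} \<in> edges H"
  shows "u \<in> verts H" "v \<in> verts H" "w \<in> verts H" "u \<noteq> v" "v \<noteq> w" "u \<noteq> w"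
proof -
  have *: "{u, v, w} \<subseteq> verts H" "card {u, v, w} = 3"
    using assms by (auto simp: wf_hypergraph_def)
  then show "u \<in> verts H" "v \<in> verts H" "w \<in> verts H" by auto
  show "u \<noteq> v" "v \<noteq> w" "u \<noteq> w"
    using *(2) by (auto simp: card_insert_if split: if_splits)
qed

text \<open>\<open>apex_pair H a b\<close> and \<open>base_pair H b c\<close> say that in some (not necessarily
  induced) copy \<open>abc, abd, acd\<close> of \<open>K\<^sub>4\<^sup>-\<close> the pair contains, respectively avoids, the
  vertex \<open>a\<close> of degree three.\<close>

definition apex_pair :: "'a hypergraph \<Rightarrow> 'a \<Rightarrow> 'a \<Rightarrow> bool" where
  "apex_pair H a b \<longleftrightarrow> (\<exists>c d. {a, b, c} \<in> edges H \<and> {a, b, d} \<in> edges H \<and> {a, c, d} \<in> edges H)"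

definition base_pair :: "'a hypergraph \<Rightarrow> 'a \<Rightarrow> 'a \<Rightarrow> bool" where
  "base_pair H b c \<longleftrightarrow> (\<exists>a d. {a, b, c} \<in> edges H \<and> {a, b, d} \<in> edges H \<and> {a, c, d} \<in> edges H)"

lemma base_pair_sym: "base_pair H b c \<Longrightarrow> base_pair H c b"
  unfolding base_pair_def by (auto simp: insert_commute)

lemma relpow_append:
  assumes "(x, y) \<in> R ^^ m" "(y, z) \<in> R ^^ n" "k = m + n"
  shows "(x, z) \<in> R ^^ k"
  using assms by (auto simp: relpow_add)

lemma apex_pair_walk4:
  assumes "apex_pair H a b"
  shows "((b, a), (a, b)) \<in> tight_step H ^^ 4"
proof -
  obtain c d where e: "{a, b, c} \<in> edges H" "{a, b, d} \<in> edges H" "{a, c, d} \<in> edges H"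
    using assms by (auto simp: apex_pair_def)
  \<comment> \<open>Vertex sequence \<open>b a c d a b\<close>.\<close>
  have "((b, a), (a, c)) \<in> tight_step H" "((a, c), (c, d)) \<in> tight_step H"
    "((c, d), (d, a)) \<in> tight_step H" "((d, a), (a, b)) \<in> tight_step H"
    using e by (simp_all add: tight_step_iff insert_commute)
  then show ?thesis
    by (auto simp: numeral_eq_Suc)
qed

lemma apex_pair_walk5:
  assumes "apex_pair H a b"
  shows "((a, b), (b, a)) \<in> tight_step H ^^ 5"
proof -
  obtain c d where e: "{a, b, c} \<in> edges H" "{a, b, d} \<in> edges H" "{a, c, d} \<in> edges H"
    using assms by (auto simp: apex_pair_def)
  \<comment> \<open>Vertex sequence \<open>a b c a d b a\<close>.\<close>
  have "((a, b), (b, c)) \<in> tight_step H" "((b, c), (c, a)) \<in> tight_step H"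
    "((c, a), (a, d)) \<in> tight_step H" "((a, d), (d, b)) \<in> tight_step H"
    "((d, b), (b, a)) \<in> tight_step H"
    using e by (simp_all add: tight_step_iff insert_commute)
  then show ?thesis
    by (auto simp: numeral_eq_Suc)
qed

text \<open>With apex \<open>a\<close>, the walk moves from \<open>bc\<close> to \<open>ca\<close>,
  reverses this pair in four steps, and returns from \<open>ac\<close> to \<open>cb\<close> through
  the same edge.\<close>

lemma base_pair_walk6:
  assumes "base_pair H b c"
  shows "((b, c), (c, b)) \<in> tight_step H ^^ 6"
proof -
  obtain a d where e: "{a, b, c} \<in> edges H" "{a, b, d} \<in> edges H" "{a, c, d} \<in> edges H"
    using assms by (auto simp: base_pair_def)
  then have "apex_pair H a c"
    unfolding apex_pair_def by (intro exI[of _ b] exI[of _ d]) (simp add: insert_commute)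
  then have 4: "((c, a), (a, c)) \<in> tight_step H ^^ 4" by (rule apex_pair_walk4)
  have 1: "((b, c), (c, a)) \<in> tight_step H ^^ 1" "((a, c), (c, b)) \<in> tight_step H ^^ 1"
    using e by (simp_all add: tight_step_iff insert_commute)
  show ?thesis
    by (rule relpow_append[OF 1(1) relpow_append[OF 4 1(2) refl]]) simp
qed

text \<open>The apex is the vertex shared by two pairs of the edge that have a common neighbour; the
  third pair is the base.\<close>

lemma edge_apex:
  assumes "wf_hypergraph H" "{x, y, z} \<in> edges H"
    and codeg: "\<And>u v. u \<in> verts H \<Longrightarrow> v \<in> verts H \<Longrightarrow> u \<noteq> v \<Longrightarrow>
      card (verts H) < 3 * codegree H {u, v}"
  shows "apex_pair H x y \<and> apex_pair H x z \<and> base_pair H y z \<or>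
    apex_pair H y x \<and> apex_pair H y z \<and> base_pair H x z \<or>
    apex_pair H z x \<and> apex_pair H z y \<and> base_pair H x y"
proof -
  define N where "N = (\<lambda>u v. {w \<in> verts H. {u, v, w} \<in> edges H})"
  have N: "codegree H {u, v} = card (N u v)" for u v
    by (simp add: codegree_def N_def insert_commute)
  have fin: "finite (verts H)" using assms(1) by (simp add: wf_hypergraph_def)
  have sub: "N u v \<subseteq> verts H" for u v by (auto simp: N_def)
  then have fN: "finite (N u v)" for u v using fin finite_subset by blast
  note d = wf_hypergraph_edgeD[OF assms(1,2)]
  have meet: "N x y \<inter> N x z \<noteq> {} \<or> N x y \<inter> N y z \<noteq> {} \<or> N x z \<inter> N y z \<noteq> {}"
  proof (rule ccontr)
    assume "\<not> ?thesis"
    then have "card (N x y \<union> N x z \<union> N y z) = card (N x y) + card (N x z) + card (N y z)"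
      using fN by (subst card_Un_disjoint, auto)+
    moreover have "card (N x y \<union> N x z \<union> N y z) \<le> card (verts H)"
      using sub fin by (intro card_mono) auto
    moreover have "card (verts H) < 3 * card (N x y)" "card (verts H) < 3 * card (N x z)"
      "card (verts H) < 3 * card (N y z)"
      using codeg d by (simp_all flip: N)
    ultimately show False by linarith
  qed
  have star: "apex_pair H a b \<and> apex_pair H a c \<and> base_pair H b c"
    if "{a, b, c} \<in> edges H" "{a, b, d} \<in> edges H" "{a, c, d} \<in> edges H" for a b c d
  proof (intro conjI)
    show "apex_pair H a b" "base_pair H b c"
      unfolding apex_pair_def base_pair_def using that by blast+
    show "apex_pair H a c"
      unfolding apex_pair_def using that
      by (intro exI[of _ b] exI[of _ d]) (simp add: insert_commute)
  qed
  consider w where "w \<in> N x y \<inter> N x z" | w where "w \<in> N x y \<inter> N y z" | w where "w \<in> N x z \<inter> N y z"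
    using meet by blast
  then show ?thesis
  proof cases
    case 1 then show ?thesis using star[of x y z w] assms(2) by (simp add: N_def)
  next
    case 2 then show ?thesis using star[of y x z w] assms(2) by (simp add: N_def insert_commute)
  next
    case 3 then show ?thesis using star[of z x y w] assms(2) by (simp add: N_def insert_commute)
  qed
qed

theorem closed_walk_10:
  assumes wf: "wf_hypergraph H" and two: "card (verts H) \<ge> 2"
    and codeg: "\<And>u v. u \<in> verts H \<Longrightarrow> v \<in> verts H \<Longrightarrow> u \<noteq> v \<Longrightarrow>
      card (verts H) < 3 * codegree H {u, v}"
  obtains p where "(p, p) \<in> tight_step H ^^ 10"
proof (rule ccontr)
  assume "\<not> thesis"
  with that have no: "(p, p) \<notin> tight_step H ^^ 10" for p by blast
  \<comment> \<open>Two reversals of the same pair close up: five plus five steps here, four plus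
    six in \<open>excl2\<close>.\<close>
  have excl1: "\<not> (apex_pair H u v \<and> apex_pair H v u)" for u v
    using no relpow_append[OF apex_pair_walk5 apex_pair_walk5, of H u v 10] by auto
  have excl2: "\<not> (apex_pair H u v \<and> base_pair H u v)" for u v
    using no relpow_append[OF apex_pair_walk4 base_pair_walk6, of H u v 10] by auto
  define V where "V = verts H"
  define m where "m = card V"
  have fin: "finite V" using wf by (simp add: wf_hypergraph_def V_def)
  define Bs where "Bs = (\<lambda>x. {y \<in> V. base_pair H x y})"
  \<comment> \<open>Arrows point to the apex, so \<open>Out x\<close> collects the apices
    \<open>y\<close> of pairs \<open>xy\<close>.\<close>
  define Out where "Out = (\<lambda>x. {y \<in> V. apex_pair H y x})"
  define In where "In = (\<lambda>x. {y \<in> V. apex_pair H x y})"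
  define N where "N = (\<lambda>u v. {w \<in> V. {u, v, w} \<in> edges H})"
  have rot: "{w, u, v} = {u, v, w}" for u v w :: 'a by auto
  have N: "m < 3 * card (N u v)" if "u \<in> V" "v \<in> V" "u \<noteq> v" for u v
    using codeg[of u v] that by (simp add: codegree_def N_def V_def m_def rot)
  have finite: "finite (Bs x)" "finite (Out x)" "finite (In x)" for x
    using fin by (auto simp: Bs_def Out_def In_def)
  have irrefl: "\<not> apex_pair H x x" "\<not> base_pair H x x" for x
    unfolding apex_pair_def base_pair_def by (blast dest: wf_hypergraph_edgeD[OF wf])+
  note apex = edge_apex[OF wf _ codeg]
  \<comment> \<open>The edge has some apex by \<open>edge_apex\<close>. Apex \<open>x\<close>
    contradicts \<open>excl1\<close> and apex \<open>y\<close> contradicts \<open>excl2\<close>,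
    which leaves \<open>z\<close>. In \<open>apex2\<close> the base pair excludes both of its
    ends.\<close>
  have apex1: "base_pair H x y" if "{x, z, y} \<in> edges H" "apex_pair H z x" for x y z
    using apex[OF that(1)] excl1[of x z] excl2[of z x] base_pair_sym[of H x z] that(2) by blast
  have apex2: "apex_pair H z x" if "{x, y, z} \<in> edges H" "base_pair H x y" for x y z
    using apex[OF that(1)] excl2[of x y] excl2[of y x] base_pair_sym[of H x y] that(2) by blast
  have tri: "card (Bs x) + card (Out x) + card (In x) \<le> m - 1" if "x \<in> V" for x
  proof -
    have "Bs x \<inter> Out x = {}" "Bs x \<inter> In x = {}" "Out x \<inter> In x = {}"
      unfolding Bs_def Out_def In_def using excl1 excl2 base_pair_sym[of H] by blast+
    then have "card (Bs x) + card (Out x) + card (In x) = card (Bs x \<union> Out x \<union> In x)"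
      using finite by (subst card_Un_disjoint, auto)+
    also have "\<dots> \<le> card (V - {x})"
      using fin irrefl by (intro card_mono) (auto simp: Bs_def Out_def In_def)
    finally show ?thesis using that fin by (simp add: m_def)
  qed
  \<comment> \<open>By \<open>apex1\<close>, the neighbourhood of an arrow leaving \<open>x\<close>
    lies in \<open>Bs x\<close>. In \<open>Out_large\<close>, \<open>apex2\<close> puts the
    neighbourhood of a base pair at \<open>x\<close> into \<open>Out x\<close>. So if one class is
    nonempty, both are large.\<close>
  have Bs_large: "m < 3 * card (Bs x)" if x: "x \<in> V" "Out x \<noteq> {}" for x
  proof -
    obtain z where z: "z \<in> V" "apex_pair H z x" using x by (auto simp: Out_def)
    have "N x z \<subseteq> Bs x"
      using apex1 z by (auto simp: N_def Bs_def)
    then have "card (N x z) \<le> card (Bs x)" using finite by (intro card_mono)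
    moreover have "x \<noteq> z" using z irrefl by auto
    ultimately show ?thesis using N[of x z] z that by linarith
  qed
  have Out_large: "m < 3 * card (Out x)" if x: "x \<in> V" "Bs x \<noteq> {}" for x
  proof -
    obtain y where y: "y \<in> V" "base_pair H x y" using x by (auto simp: Bs_def)
    have "N x y \<subseteq> Out x"
      using apex2 y by (auto simp: N_def Out_def)
    then have "card (N x y) \<le> card (Out x)" using finite by (intro card_mono)
    moreover have "x \<noteq> y" using y irrefl by auto
    ultimately show ?thesis using N[of x y] y that by linarith
  qed
  have one_sink: "x = y" if "x \<in> V" "y \<in> V" "Out x = {}" "Out y = {}" for x y
  proof (rule ccontr)
    assume "x \<noteq> y"
    then have "N x y \<noteq> {}" using N[of x y] that by auto
    then obtain z where z: "{x, y, z} \<in> edges H" by (auto simp: N_def)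
    \<comment> \<open>A sink has no base pair either, by \<open>Out_large\<close>, yet the edge
      \<open>xyz\<close> requires an arrow between \<open>x\<close> and \<open>y\<close> or the base
      pair \<open>xy\<close>.\<close>
    have "Bs x = {}" "Bs y = {}" using Bs_large Out_large that by force+
    then show False
      using apex[OF z] that by (auto simp: Out_def Bs_def)
  qed
  \<comment> \<open>If there is no sink, any vertex serves as \<open>s\<close>.\<close>
  obtain s where s: "s \<in> V" "\<And>x. x \<in> V - {s} \<Longrightarrow> Out x \<noteq> {}"
  proof (cases "\<exists>s\<in>V. Out s = {}")
    case True then show ?thesis using one_sink that by blast
  next
    case False
    moreover have "V \<noteq> {}" using two by (auto simp: V_def)
    ultimately show ?thesis using that by blast
  qed
  define W where "W = V - {s}"
  have W: "finite W" "card W = m - 1" "V = insert s W" "s \<notin> W"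
    using fin s by (auto simp: W_def m_def)
  have m2: "m \<ge> 2" using two by (simp add: m_def V_def)
  \<comment> \<open>The least integer with \<open>m < 3 * d\<close>.\<close>
  define d where "d = m div 3 + 1"
  have d: "m < 3 * d" unfolding d_def by presburger
  have d_le: "d \<le> k" if "m < 3 * k" for k using that unfolding d_def by presburger
  have Wx: "d \<le> card (Out x)" "card (In x) + 2 * d \<le> m - 1" if "x \<in> W" for x
  proof -
    have x: "x \<in> V" "Out x \<noteq> {}" using s that by (auto simp: W_def)
    from Bs_large[OF x] have b: "d \<le> card (Bs x)" "Bs x \<noteq> {}" by (auto intro: d_le)
    from Out_large[OF x(1) b(2)] show o: "d \<le> card (Out x)" by (auto intro: d_le)
    show "card (In x) + 2 * d \<le> m - 1" using tri[OF x(1)] b o by linarith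
  qed
  have "(\<Sum>x\<in>V. card (Out x)) = card (SIGMA x:V. Out x)" using fin finite by simp
  also have "\<dots> = card (SIGMA x:V. In x)"
    by (rule bij_betw_same_card[of prod.swap])
       (auto simp: bij_betw_def inj_on_def Out_def In_def image_iff)
  also have "\<dots> = (\<Sum>x\<in>V. card (In x))" using fin finite by simp
  finally have eq: "(\<Sum>x\<in>V. card (Out x)) = (\<Sum>x\<in>V. card (In x))" .
  have "(m - 1) * d = (\<Sum>x\<in>W. d)" using W by simp
  also have "\<dots> \<le> (\<Sum>x\<in>W. card (Out x))" using Wx by (intro sum_mono) auto
  also have "\<dots> \<le> (\<Sum>x\<in>V. card (Out x))" using W by simp
  finally have "(m - 1) * d \<le> (\<Sum>x\<in>V. card (In x))" by (simp add: eq)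
  \<comment> \<open>The in-degree of \<open>s\<close> may reach \<open>m - 1\<close>, but
    \<open>tri\<close> has \<open>m - 1\<close> instead of \<open>m\<close> and so saves one at
    every other vertex. The two balance to \<open>3 * d \<le> m\<close>, against the choice of
    \<open>d\<close>.\<close>
  then have "(m - 1) * d + (\<Sum>x\<in>W. 2 * d) \<le> card (In s) + (\<Sum>x\<in>W. card (In x) + 2 * d)"
    using W by (simp add: sum.distrib mult.commute)
  also have "\<dots> \<le> (m - 1) + (\<Sum>x\<in>W. m - 1)"
    using tri[OF s(1)] Wx by (intro add_mono sum_mono) auto
  finally have *: "(m - 1) * d + (m - 1) * (2 * d) \<le> (m - 1) + (m - 1) * (m - 1)"
    using W by simp
  obtain k where k: "m = Suc (Suc k)" using m2 by (metis add_2_eq_Suc le_Suc_ex)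
  have "(m - 1) * (3 * d) \<le> (m - 1) * m" using * by (simp add: k algebra_simps)
  then show False using d m2 by (simp only: mult_le_cancel1) linarith
qed

text \<open>The pair \<open>p\<close> starts an edge, and going round its three vertices is a closed
  walk of length 3 at \<open>p\<close>. Closed walks at the same pair concatenate.\<close>

lemma closed_walk_exists:
  assumes wf: "wf_hypergraph H" and two: "card (verts H) \<ge> 2"
    and codeg: "\<And>u v. u \<in> verts H \<Longrightarrow> v \<in> verts H \<Longrightarrow> u \<noteq> v \<Longrightarrow>
      card (verts H) < 3 * codegree H {u, v}"
    and l: "l = 10 * a + 3 * b"
  obtains p where "(p, p) \<in> tight_step H ^^ l"
proof -
  obtain p where p: "(p, p) \<in> tight_step H ^^ 10"
    using closed_walk_10[OF wf two codeg] by blast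
  obtain u v where uv: "p = (u, v)" by fastforce
  have "(p, p) \<in> tight_step H ^^ Suc 9"
    using p by simp
  then obtain w where e: "{u, v, w} \<in> edges H"
    by (rule relpow_Suc_E2) (auto simp: uv tight_step_def)
  have "((u, v), (v, w)) \<in> tight_step H" "((v, w), (w, u)) \<in> tight_step H"
    "((w, u), (u, v)) \<in> tight_step H"
    using e by (simp_all add: tight_step_iff insert_commute)
  then have p3: "(p, p) \<in> tight_step H ^^ 3" by (auto simp: numeral_eq_Suc uv)
  have mult: "(p, p) \<in> tight_step H ^^ (c * k)" if "(p, p) \<in> tight_step H ^^ c" for c k
  proof (induction k)
    case (Suc k)
    then show ?case using relpow_append[OF that, of p "c * k"] by simp
  qed simp
  show ?thesis
    by (rule that, rule relpow_append[OF mult[OF p, of a] mult[OF p3, of b] l(1)])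
qed

subsection \<open>Boxes in dense relations\<close>

lemma card_PiE_slices:
  assumes "finite I" "i \<notin> I" "finite V" "R \<subseteq> PiE (insert i I) (\<lambda>_. V)"
  shows "card R = (\<Sum>v\<in>V. card {x \<in> PiE I (\<lambda>_. V). x(i := v) \<in> R})"
proof -
  define R' where "R' = (SIGMA v:V. {x \<in> PiE I (\<lambda>_. V). x(i := v) \<in> R})"
  have fin: "finite (PiE I (\<lambda>_. V))" using assms by (intro finite_PiE) auto
  have "(\<lambda>(v, x). x(i := v)) ` R' = R"
  proof
    show "R \<subseteq> (\<lambda>(v, x). x(i := v)) ` R'"
      using assms(4) unfolding PiE_insert_eq R'_def by auto
  qed (auto simp: R'_def)
  moreover have "inj_on (\<lambda>(v, x). x(i := v)) R'"
    by (rule inj_on_subset[OF inj_combinator[OF assms(2), of "\<lambda>_. V"]]) (auto simp: R'_def)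
  ultimately have "card R = card R'" using card_image by metis
  also have "\<dots> = (\<Sum>v\<in>V. card {x \<in> PiE I (\<lambda>_. V). x(i := v) \<in> R})"
    unfolding R'_def using assms fin by (subst card_SigmaI) auto
  finally show ?thesis .
qed

text \<open>Reverse Markov inequality: values below \<open>a\<close> contribute at most
  \<open>a\<close> each, all others at most \<open>M\<close>. A large average thus forces many large
  values.\<close>

lemma sum_le_card_large:
  fixes f :: "'a \<Rightarrow> real"
  assumes "finite A" "\<And>x. x \<in> A \<Longrightarrow> f x \<le> M" "a \<ge> 0" "M \<ge> 0"
  shows "sum f A \<le> real (card {x \<in> A. a \<le> f x}) * M + real (card A) * a"
proof -
  have "sum f A \<le> (\<Sum>x\<in>A. (if a \<le> f x then M else 0) + a)"
    using assms by (intro sum_mono) force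
  also have "\<dots> = real (card {x \<in> A. a \<le> f x}) * M + real (card A) * a"
    using assms by (simp add: sum.distrib flip: sum.inter_filter)
  finally show ?thesis .
qed

text \<open>Erdos's theorem on complete partite subgraphs. Among a bounded number of dense slices in the
  new coordinate, many points lie in at least \<open>t\<close> of them and, by pigeonhole, in the same \<open>t\<close>.\<close>

theorem dense_contains_box:
  fixes c :: real
  assumes "finite I" "c > 0"
  shows "\<exists>n0. \<forall>(V :: 'b set) R. finite V \<longrightarrow> n0 \<le> card V \<longrightarrow> R \<subseteq> PiE I (\<lambda>_. V) \<longrightarrow>
    c * real (card V) ^ card I \<le> real (card R) \<longrightarrow>
    (\<exists>A. (\<forall>i\<in>I. A i \<subseteq> V \<and> t \<le> card (A i)) \<and> PiE I A \<subseteq> R)"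
  using assms
proof (induction I arbitrary: c rule: finite_induct)
  case (empty c)
  \<comment> \<open>The product over no coordinates is a single point, and positive density makes
    \<open>R\<close> nonempty.\<close>
  have "PiE {} A \<subseteq> R"
    if "R \<subseteq> PiE {} (\<lambda>_. V)" "c * real (card V) ^ card {} \<le> real (card R)" for V R A
    using that empty by (cases "R = {}") (auto simp: subset_singleton_iff)
  then show ?case by blast
next
  case (insert i I c)
  \<comment> \<open>On average a point lies in at least \<open>M * c / 2\<close> of \<open>M\<close>
    slices of density \<open>c / 2\<close>. This is at least \<open>2 * t\<close>, so points in
    fewer than \<open>t\<close> slices account for at most half of the incidences.\<close>
  define M where "M = Suc (nat \<lceil>4 * real t / c\<rceil>)"
  have M: "real t \<le> real M * c / 4" "M > 0"
  proof -
    have "4 * real t / c \<le> real M" unfolding M_def by linarith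
    then show "real t \<le> real M * c / 4" using insert.prems by (simp add: field_simps)
  qed (simp add: M_def)
  \<comment> \<open>The density of the points in \<open>t\<close> slices is at least
    \<open>c / 4\<close>, and \<open>2 ^ M\<close> counts the sets of slices in the pigeonhole
    step.\<close>
  define c' where "c' = c / 4 / 2 ^ M"
  have "c' > 0" using insert.prems by (simp add: c'_def)
  obtain n1 where n1: "\<forall>(V :: 'b set) R. finite V \<longrightarrow> n1 \<le> card V \<longrightarrow>
      R \<subseteq> PiE I (\<lambda>_. V) \<longrightarrow> c' * real (card V) ^ card I \<le> real (card R) \<longrightarrow>
      (\<exists>A. (\<forall>i\<in>I. A i \<subseteq> V \<and> t \<le> card (A i)) \<and> PiE I A \<subseteq> R)"
    by (rule exE[OF insert.IH[OF \<open>c' > 0\<close>]])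
  define n0 where "n0 = max n1 (nat \<lceil>2 * real M / c\<rceil> + 1)"
  have "\<exists>A. (\<forall>j\<in>insert i I. A j \<subseteq> V \<and> t \<le> card (A j)) \<and> PiE (insert i I) A \<subseteq> R"
    if V: "finite V" "n0 \<le> card V" and R: "R \<subseteq> PiE (insert i I) (\<lambda>_. V)"
      and dense: "c * real (card V) ^ card (insert i I) \<le> real (card R)" for V :: "'b set" and R
  proof -
    define n where "n = real (card V)"
    define r where "r = card I"
    have n: "n > 0" "2 * real M / c \<le> n"
      using V(2) by (auto simp: n0_def n_def; linarith)+
    define P where "P = PiE I (\<lambda>_. V)"
    have P: "finite P" "real (card P) = n ^ r"
      using V insert.hyps by (auto simp: P_def n_def r_def card_PiE intro!: finite_PiE)
    define S where "S = (\<lambda>v. {x \<in> P. x(i := v) \<in> R})"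
    have S: "real (card (S v)) \<le> n ^ r" for v
      unfolding P(2)[symmetric] S_def by (intro of_nat_mono card_mono P) auto
    \<comment> \<open>By averaging there are at least \<open>c / 2 * n\<close> slices of density
      \<open>c / 2\<close>, and \<open>n0\<close> makes this at least \<open>M\<close>.\<close>
    define G where "G = {v \<in> V. c / 2 * n ^ r \<le> real (card (S v))}"
    have "c * n ^ Suc r \<le> (\<Sum>v\<in>V. real (card (S v)))"
      using dense card_PiE_slices[OF insert.hyps V(1) R] insert.hyps
      by (simp add: n_def r_def S_def P_def)
    also have "\<dots> \<le> real (card G) * n ^ r + real (card V) * (c / 2 * n ^ r)"
      unfolding G_def using V S n insert.prems by (intro sum_le_card_large) auto
    finally have "c / 2 * n * n ^ r \<le> real (card G) * n ^ r"
      by (simp add: n_def algebra_simps)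
    then have "c / 2 * n \<le> real (card G)" using n by simp
    moreover have "real M \<le> c / 2 * n" using n insert.prems by (simp add: field_simps)
    ultimately have "M \<le> card G" by linarith
    then obtain G' where G': "G' \<subseteq> G" "card G' = M" "finite G'"
      by (metis obtain_subset_with_card_n)
    define T where "T = (\<lambda>x. {v \<in> G'. x(i := v) \<in> R})"
    have T: "card (T x) \<le> M" for x
      using G' by (auto simp: T_def intro: card_mono)
    define X where "X = {x \<in> P. real t \<le> real (card (T x))}"
    have "(\<Sum>v\<in>G'. card (S v)) = card (SIGMA v:G'. S v)"
      using G' P by (subst card_SigmaI) (auto simp: S_def)
    also have "\<dots> = card (SIGMA x:P. T x)"
      by (rule bij_betw_same_card[of prod.swap])
         (auto simp: bij_betw_def inj_on_def S_def T_def image_iff)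
    also have "\<dots> = (\<Sum>x\<in>P. card (T x))"
      using G' P by (subst card_SigmaI) (auto simp: T_def)
    finally have swap: "(\<Sum>v\<in>G'. real (card (S v))) = (\<Sum>x\<in>P. real (card (T x)))"
      by (metis of_nat_sum)
    have "real M * (c / 2 * n ^ r) = (\<Sum>v\<in>G'. c / 2 * n ^ r)" using G' by simp
    also have "\<dots> \<le> (\<Sum>v\<in>G'. real (card (S v)))"
      using G' by (intro sum_mono) (auto simp: G_def)
    also have "\<dots> \<le> real (card X) * real M + n ^ r * real t"
      unfolding swap X_def P(2)[symmetric] using P T by (intro sum_le_card_large) auto
    also have "\<dots> \<le> real (card X) * real M + n ^ r * (real M * c / 4)"
      using M n by (intro add_left_mono mult_left_mono) auto
    finally have "real M * (c / 4 * n ^ r) \<le> real M * real (card X)"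
      by (simp add: algebra_simps)
    then have X: "c / 4 * n ^ r \<le> real (card X)" using M by simp
    have finX: "finite X" using P by (simp add: X_def)
    have "T \<in> X \<rightarrow> Pow G'" by (auto simp: T_def)
    then obtain T0 where T0: "card X \<le> card (T -` {T0} \<inter> X) * card (Pow G')"
      using pigeonhole_card[of T X "Pow G'"] finX G' by auto
    define Q where "Q = T -` {T0} \<inter> X"
    have "c' * n ^ r = c / 4 * n ^ r / 2 ^ M" by (simp add: c'_def)
    also have "\<dots> \<le> real (card X) / 2 ^ M" using X by (intro divide_right_mono) auto
    also have "\<dots> \<le> real (card Q)"
      using of_nat_mono[OF T0, where ?'a = real] G'
      by (simp add: Q_def card_Pow field_simps)
    finally have Q: "c' * n ^ r \<le> real (card Q)" .
    moreover have "0 < c' * n ^ r" using n \<open>c' > 0\<close> by simp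
    ultimately have "Q \<noteq> {}" by auto
    then have T0': "t \<le> card T0" "T0 \<subseteq> V"
      using G' by (auto simp: Q_def X_def T_def G_def)
    have "Q \<subseteq> PiE I (\<lambda>_. V)" by (auto simp: Q_def X_def P_def)
    then have "\<exists>A. (\<forall>j\<in>I. A j \<subseteq> V \<and> t \<le> card (A j)) \<and> PiE I A \<subseteq> Q"
      using n1[rule_format, of V Q] V Q by (simp add: n_def r_def n0_def)
    then obtain A where A: "\<forall>j\<in>I. A j \<subseteq> V \<and> t \<le> card (A j)" "PiE I A \<subseteq> Q"
      by blast
    have "PiE (insert i I) (A(i := T0)) \<subseteq> R"
    proof
      fix y assume "y \<in> PiE (insert i I) (A(i := T0))"
      then obtain v x where y: "y = x(i := v)" "v \<in> T0" "x \<in> PiE I (A(i := T0))"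
        unfolding PiE_insert_eq by auto
      have "PiE I (A(i := T0)) = PiE I A" using insert.hyps by (intro PiE_cong) auto
      then have "x \<in> Q" using y A by auto
      then have "v \<in> T x" using y by (auto simp: Q_def)
      then show "y \<in> R" using y by (auto simp: T_def)
    qed
    then show ?thesis using A T0' insert.hyps
      by (intro exI[of _ "A(i := T0)"]) auto
  qed
  then show ?case by blast
qed

lemma injective_choice:
  assumes "finite J" "\<And>j. j \<in> J \<Longrightarrow> card J \<le> card (B j)"
  shows "\<exists>f. inj_on f J \<and> (\<forall>j\<in>J. f j \<in> B j)"
  using assms
proof (induction J rule: finite_induct)
  case (insert j J)
  then obtain f where f: "inj_on f J" "\<forall>j\<in>J. f j \<in> B j" by fastforce
  have "card (f ` J) < card (B j)"
    using insert.prems[of j] insert.hyps f by (simp add: card_image)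
  then obtain b where "b \<in> B j" "b \<notin> f ` J"
    by (metis card_mono finite_imageI insert.hyps(1) leD subsetI)
  then show ?case using f insert.hyps
    by (intro exI[of _ "f(j := b)"]) (auto simp: inj_on_def)
qed simp

subsection \<open>Random samples\<close>

text \<open>Chernoff bound: a hit has weight \<open>s ^ 3\<close>, so the threshold of \<open>card I / 3\<close> hits has weight
  \<open>s ^ card I\<close>.\<close>

lemma card_few_hits:
  fixes s :: real
  assumes "finite I" "i \<in> I" "j \<in> I" "i \<noteq> j" "finite V" "u \<in> V" "v \<in> V" "N \<subseteq> V"
    and s: "0 < s" "s \<le> 1"
  shows "real (card {x \<in> PiE I (\<lambda>_. V). x i = u \<and> x j = v \<and>
            3 * card {k \<in> I - {i, j}. x k \<in> N} \<le> card I}) * s ^ card I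
         \<le> (real (card V) - (1 - s ^ 3) * real (card N)) ^ (card I - 2)"
    (is "real (card ?B) * _ \<le> _")
proof -
  define J where "J = I - {i, j}"
  have I: "I = insert i (insert j J)" "finite J" "i \<notin> insert j J" "j \<notin> J" "card J = card I - 2"
    using assms by (auto simp: J_def card_Diff_subset)
  \<comment> \<open>The weight of a sample becomes a product over coordinates, so that its sum over
    all samples factorises: indicators of \<open>x i = u\<close> and \<open>x j = v\<close>, and a
    factor \<open>s ^ 3\<close> per hit.\<close>
  define h where "h = (\<lambda>k y. if k = i then of_bool (y = u) else if k = j then of_bool (y = v)
    else if y \<in> N then s ^ 3 else 1)"
  have h_nonneg: "0 \<le> h k y" for k y using s by (simp add: h_def)
  have split: "(\<Prod>k\<in>I. g k) = g i * g j * (\<Prod>k\<in>J. g k)" for g :: "'a \<Rightarrow> real"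
    using I by simp
  have "real (card ?B) * s ^ card I = (\<Sum>x\<in>?B. s ^ card I)" by simp
  also have "\<dots> \<le> (\<Sum>x\<in>?B. \<Prod>k\<in>I. h k (x k))"
  proof (intro sum_mono)
    fix x assume x: "x \<in> ?B"
    have "(\<Prod>k\<in>J. h k (x k)) = (\<Prod>k\<in>J. if x k \<in> N then s ^ 3 else 1)"
      by (intro prod.cong) (auto simp: h_def J_def)
    also have "\<dots> = (\<Prod>k\<in>{k \<in> J. x k \<in> N}. s ^ 3)"
      using I(2) by (rule prod.inter_filter[symmetric])
    also have "\<dots> = s ^ (3 * card {k \<in> J. x k \<in> N})"
      by (simp add: power_mult)
    finally have "(\<Prod>k\<in>I. h k (x k)) = s ^ (3 * card {k \<in> J. x k \<in> N})"
      using x assms(4) unfolding split by (simp add: h_def)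
    then show "s ^ card I \<le> (\<Prod>k\<in>I. h k (x k))"
      using x s by (auto simp: J_def intro: power_decreasing)
  qed
  also have "\<dots> \<le> (\<Sum>x\<in>PiE I (\<lambda>_. V). \<Prod>k\<in>I. h k (x k))"
    using assms by (intro sum_mono2 finite_PiE prod_nonneg h_nonneg) auto
  also have "\<dots> = (\<Prod>k\<in>I. \<Sum>y\<in>V. h k y)"
    using assms by (intro prod_sum_PiE[symmetric]) auto
  also have "\<dots> = (\<Prod>k\<in>J. \<Sum>y\<in>V. if y \<in> N then s ^ 3 else 1)"
  proof -
    have "(\<Sum>y\<in>V. h i y) = 1" "(\<Sum>y\<in>V. h j y) = 1"
      using assms by (simp_all add: h_def of_bool_def)
    moreover have "(\<Prod>k\<in>J. \<Sum>y\<in>V. h k y) = (\<Prod>k\<in>J. \<Sum>y\<in>V. if y \<in> N then s ^ 3 else 1)"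
      by (intro prod.cong sum.cong) (auto simp: h_def J_def)
    ultimately show ?thesis unfolding split by simp
  qed
  also have "(\<Sum>y\<in>V. if y \<in> N then s ^ 3 else 1) = (\<Sum>y\<in>V. 1 - (1 - s ^ 3) * of_bool (y \<in> N))"
    by (intro sum.cong) auto
  also have "\<dots> = real (card V) - (1 - s ^ 3) * real (card N)"
    using assms by (simp add: sum_subtractf Int_absorb1 flip: sum_distrib_left)
  finally show ?thesis using I(5) by simp
qed

text \<open>The vertices are the sample indices, so that walks in different samples can be compared.
  For well-formed \<open>H\<close>, indices with the same image lie in no common edge.\<close>

definition pullback :: "'b set \<Rightarrow> ('b \<Rightarrow> 'a) \<Rightarrow> 'a hypergraph \<Rightarrow> 'b hypergraph" where
  "pullback I x H = \<lparr>verts = I, edges = {e. e \<subseteq> I \<and> card e = 3 \<and> x ` e \<in> edges H}\<rparr>"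

lemma wf_pullback: "finite I \<Longrightarrow> wf_hypergraph (pullback I x H)"
  by (auto simp: wf_hypergraph_def pullback_def)

lemma codegree_pullback:
  assumes "i \<in> I" "j \<in> I" "i \<noteq> j"
  shows "codegree (pullback I x H) {i, j} = card {k \<in> I - {i, j}. {x k, x i, x j} \<in> edges H}"
proof -
  have "{k \<in> I. card {k, i, j} = 3 \<and> {x k, x i, x j} \<in> edges H} =
    {k \<in> I - {i, j}. {x k, x i, x j} \<in> edges H}"
    using assms by (auto simp: card_insert_if)
  then show ?thesis
    using assms by (simp add: codegree_def pullback_def conj_commute cong: conj_cong)
qed

text \<open>Union bound. Either \<open>x i = x j\<close>, which gives the term \<open>1 / n\<close>,
  or \<open>x i\<close> and \<open>x j\<close> form one of at most \<open>n ^ 2\<close> ordered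
  pairs of distinct vertices, and \<open>card_few_hits\<close> applies to the neighbourhood of that
  pair.\<close>

lemma card_bad_pair:
  fixes s p :: real
  assumes wf: "wf_hypergraph H" and "finite I" "i \<in> I" "j \<in> I" "i \<noteq> j"
    and s: "0 < s" "s \<le> 1" and "p \<le> 1"
    and n: "n = real (card (verts H))" "n > 0"
    and codeg: "\<And>u v. u \<in> verts H \<Longrightarrow> v \<in> verts H \<Longrightarrow> u \<noteq> v \<Longrightarrow>
      p * n \<le> real (codegree H {u, v})"
  shows "real (card {x \<in> PiE I (\<lambda>_. verts H). 3 * codegree (pullback I x H) {i, j} \<le> card I})
    \<le> n ^ card I * (1 / n + (1 - (1 - s ^ 3) * p) ^ (card I - 2) / s ^ card I)"
    (is "real (card ?B) \<le> _")
proof -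
  define V where "V = verts H"
  define m where "m = card I"
  define q where "q = 1 - (1 - s ^ 3) * p"
  have V: "finite V" using wf by (simp add: wf_hypergraph_def V_def)
  have finP: "finite (PiE I (\<lambda>_. V))" using V assms(2) by (intro finite_PiE) auto
  have s3: "s ^ 3 \<le> 1" using s by (simp add: power_le_one)
  have "card {i, j} \<le> card I" using assms by (intro card_mono) auto
  then have m2: "m \<ge> 2" using assms by (simp add: m_def)
  define F where "F = (\<lambda>(u, v). {x \<in> PiE I (\<lambda>_. V). x i = u \<and> x j = v \<and>
    3 * card {k \<in> I - {i, j}. {x k, u, v} \<in> edges H} \<le> m})"
  define C where "C = {x \<in> PiE I (\<lambda>_. V). x i = x j}"
  have C: "real (card C) \<le> n ^ (m - 1)"
  proof -
    have "inj_on (\<lambda>x. restrict x (I - {i})) C"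
    proof (rule inj_onI)
      fix x y assume *: "x \<in> C" "y \<in> C" "restrict x (I - {i}) = restrict y (I - {i})"
      have eq: "x k = y k" if "k \<in> I - {i}" for k
        using fun_cong[OF *(3), of k] that by simp
      moreover have "x i = y i" using eq[of j] * assms by (auto simp: C_def)
      ultimately have "x k = y k" if "k \<in> I" for k using that by (cases "k = i") auto
      then show "x = y"
        using * by (intro PiE_ext[of x I "\<lambda>_. V" y]) (auto simp: C_def)
    qed
    then have "card C \<le> card (PiE (I - {i}) (\<lambda>_. V))"
      using V assms by (intro card_inj_on_le[of "\<lambda>x. restrict x (I - {i})"] finite_PiE)
        (auto simp: C_def PiE_mem split: if_splits)
    also have "\<dots> = card V ^ (m - 1)" using assms by (simp add: card_PiE m_def)
    finally show ?thesis using of_nat_mono[of _ _, where ?'a = real] by (fastforce simp: n V_def)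
  qed
  have F: "real (card (F (u, v))) \<le> (q * n) ^ (m - 2) / s ^ m"
    if "u \<in> V" "v \<in> V" "u \<noteq> v" for u v
  proof -
    define N where "N = {w \<in> V. {w, u, v} \<in> edges H}"
    have N: "N \<subseteq> V" "p * n \<le> real (card N)"
      using codeg[of u v] that by (auto simp: N_def V_def codegree_def)
    have F_eq: "F (u, v) = {x \<in> PiE I (\<lambda>_. V). x i = u \<and> x j = v \<and>
        3 * card {k \<in> I - {i, j}. x k \<in> N} \<le> card I}"
    proof -
      have "{k \<in> I - {i, j}. {x k, u, v} \<in> edges H} = {k \<in> I - {i, j}. x k \<in> N}"
        if "x \<in> PiE I (\<lambda>_. V)" for x
        using that by (auto simp: N_def)
      then show ?thesis unfolding F_def m_def by (auto cong: conj_cong)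
    qed
    have "real (card (F (u, v))) * s ^ m \<le> (real (card V) - (1 - s ^ 3) * real (card N)) ^ (m - 2)"
      unfolding F_eq m_def using assms V that N s by (intro card_few_hits) auto
    also have "\<dots> \<le> (q * n) ^ (m - 2)"
    proof (rule power_mono)
      have "(1 - s ^ 3) * (p * n) \<le> (1 - s ^ 3) * real (card N)"
        using s3 N by (intro mult_left_mono) auto
      then show "real (card V) - (1 - s ^ 3) * real (card N) \<le> q * n"
        by (simp add: q_def n V_def algebra_simps)
      have "(1 - s ^ 3) * real (card N) \<le> 1 * real (card V)"
        using s s3 V N by (intro mult_mono) (auto intro: card_mono)
      then show "0 \<le> real (card V) - (1 - s ^ 3) * real (card N)" by simp
    qed
    finally show ?thesis using s by (simp add: field_simps)
  qed
  define D where "D = {(u, v) \<in> V \<times> V. u \<noteq> v}"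
  have D: "finite D" "real (card D) \<le> n ^ 2"
  proof -
    show "finite D" using V by (auto simp: D_def intro: finite_subset[of _ "V \<times> V"])
    have "card D \<le> card (V \<times> V)" using V by (intro card_mono) (auto simp: D_def)
    then show "real (card D) \<le> n ^ 2"
      by (simp add: card_cartesian_product n V_def power2_eq_square flip: of_nat_mult)
  qed
  have "(1 - s ^ 3) * p \<le> (1 - s ^ 3) * 1" using s3 \<open>p \<le> 1\<close> by (intro mult_left_mono) auto
  then have "0 \<le> q" using s by (simp add: q_def) (smt (verit) zero_less_power)
  have "?B \<subseteq> C \<union> (\<Union>uv\<in>D. F uv)"
    using assms by (auto simp: C_def D_def F_def V_def m_def codegree_pullback PiE_mem)
  then have "card ?B \<le> card (C \<union> (\<Union>uv\<in>D. F uv))"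
    using finP D by (intro card_mono finite_UnI finite_UN_I) (auto simp: C_def F_def)
  also have "\<dots> \<le> card C + (\<Sum>uv\<in>D. card (F uv))"
    using card_Un_le[of C "\<Union>uv\<in>D. F uv"] card_UN_le[OF D(1), of F] by linarith
  finally have "real (card ?B) \<le> real (card C) + (\<Sum>uv\<in>D. real (card (F uv)))"
    using of_nat_mono[where ?'a = real] by fastforce
  also have "\<dots> \<le> n ^ (m - 1) + (\<Sum>uv\<in>D. (q * n) ^ (m - 2) / s ^ m)"
    using C F by (intro add_mono sum_mono) (auto simp: D_def)
  also have "(\<Sum>uv\<in>D. (q * n) ^ (m - 2) / s ^ m) \<le> n ^ 2 * ((q * n) ^ (m - 2) / s ^ m)"
    unfolding sum_constant using D n \<open>0 \<le> q\<close> s by (intro mult_right_mono) simp_all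
  also have "n ^ (m - 1) + n ^ 2 * ((q * n) ^ (m - 2) / s ^ m) = n ^ m * (1 / n + q ^ (m - 2) / s ^ m)"
  proof -
    obtain k where "m = Suc (Suc k)" using m2 by (metis add_2_eq_Suc le_Suc_ex)
    then show ?thesis using n(2) by (simp add: field_simps power2_eq_square power_mult_distrib)
  qed
  finally show ?thesis by (simp add: q_def m_def)
qed

subsection \<open>Tight cycles from codegree above one third\<close>

text \<open>Take the first entries of the pairs; as the walk returns to its start, position
  \<open>l\<close> is identified with \<open>0\<close>.\<close>

lemma closed_walk_cyclic:
  assumes "(p, p) \<in> tight_step H ^^ l"
  obtains w where "\<And>j. j < l \<Longrightarrow> {w j, w ((j + 1) mod l), w ((j + 2) mod l)} \<in> edges H"
proof -
  obtain f where f: "f 0 = p" "f l = p" "\<And>j. j < l \<Longrightarrow> (f j, f (Suc j)) \<in> tight_step H"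
    using assms unfolding relpow_fun_conv by blast
  have periodic: "f (Suc j) = f (Suc j mod l)" if "j < l" for j
    using f that by (cases "Suc j = l") auto
  have step: "snd (f j) = fst (f (Suc j))" "{fst (f j), snd (f j), snd (f (Suc j))} \<in> edges H"
    if "j < l" for j
    using f(3)[OF that] by (auto simp: tight_step_def)
  have "{fst (f j), fst (f ((j + 1) mod l)), fst (f ((j + 2) mod l))} \<in> edges H" if "j < l" for j
  proof -
    have 1: "fst (f ((j + 1) mod l)) = snd (f j)"
      using step(1)[OF that] periodic[OF that] by simp
    have lt: "Suc j mod l < l" using that by simp
    have "fst (f ((j + 2) mod l)) = snd (f (Suc j))"
      using step(1)[OF lt] periodic[OF lt] periodic[OF that] by (simp add: mod_Suc_eq)
    then show ?thesis using step(2)[OF that] 1 by simp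
  qed
  then show ?thesis by (rule that)
qed

lemma exists_sample_size:
  fixes r C :: real
  assumes "0 \<le> r" "r < 1"
  obtains k where "C * (real k + 2)\<^sup>2 * r ^ k \<le> 1"
proof -
  \<comment> \<open>Since \<open>r ^ k\<close> is the square of \<open>y ^ k\<close>, the quadratic
    factor reduces to the limit of \<open>k * y ^ k\<close>.\<close>
  define y where "y = sqrt r"
  have y: "0 \<le> y" "y < 1" "y\<^sup>2 = r" using assms by (auto simp: y_def)
  have "(\<lambda>k. real k * y ^ k) \<longlonglongrightarrow> 0" "(\<lambda>k. y ^ k) \<longlonglongrightarrow> 0"
    using y by (auto intro: powser_times_n_limit_0 LIMSEQ_realpow_zero)
  then have "(\<lambda>k. C * (real k * y ^ k + 2 * y ^ k)\<^sup>2) \<longlonglongrightarrow> C * (0 + 2 * 0)\<^sup>2"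
    by (intro tendsto_mult tendsto_add tendsto_power tendsto_const)
  moreover have "C * (real k * y ^ k + 2 * y ^ k)\<^sup>2 = C * (real k + 2)\<^sup>2 * r ^ k" for k
    by (simp add: power_mult_distrib power_mult[symmetric] mult.commute flip: y(3) distrib_right)
  ultimately have "(\<lambda>k. C * (real k + 2)\<^sup>2 * r ^ k) \<longlonglongrightarrow> 0" by simp
  then have "\<forall>\<^sub>F k in sequentially. C * (real k + 2)\<^sup>2 * r ^ k < 1"
    by (rule order_tendstoD) simp
  then show ?thesis using that by (auto simp: eventually_sequentially intro: less_imp_le)
qed

text \<open>The walk \<open>w\<close> may repeat indices, but every part \<open>A i\<close> has room
  for \<open>l\<close> vertices, so distinct \<open>f j\<close> in \<open>A (w j)\<close> exist.
  Each edge of the cycle is checked at a point of the box that agrees with \<open>f\<close> at three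
  consecutive indices.\<close>

lemma contains_copy_of_box:
  assumes w: "\<And>j. j < l \<Longrightarrow> w j \<in> I"
    and A: "\<And>i. i \<in> I \<Longrightarrow> A i \<subseteq> verts H \<and> l \<le> card (A i)" and "l > 0"
    and walk: "\<And>x j. x \<in> PiE I A \<Longrightarrow> j < l \<Longrightarrow>
      {w j, w ((j + 1) mod l), w ((j + 2) mod l)} \<in> edges (pullback I x H)"
  shows "contains_copy H (tight_cycle l)"
proof -
  obtain f where f: "inj_on f {..<l}" "\<forall>j\<in>{..<l}. f j \<in> A (w j)"
    using injective_choice[of "{..<l}" "\<lambda>j. A (w j)"] A w by auto
  have "\<forall>i\<in>I. A i \<noteq> {}" using A \<open>l > 0\<close> by force
  then obtain z where z: "\<And>i. i \<in> I \<Longrightarrow> z i \<in> A i"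
    using bchoice[of I "\<lambda>i y. y \<in> A i"] by blast
  have "f ` {j, (j + 1) mod l, (j + 2) mod l} \<in> edges H" if "j < l" for j
  proof -
    define a b c where "a = j" and "b = (j + 1) mod l" and "c = (j + 2) mod l"
    have lt: "a < l" "b < l" "c < l" using that by (auto simp: a_def b_def c_def)
    define x where "x = (restrict z I)(w a := f a, w b := f b, w c := f c)"
    have x: "x \<in> PiE I A"
      using z w f lt by (auto simp: x_def PiE_def extensional_def)
    have e: "{w a, w b, w c} \<in> edges (pullback I x H)"
      using walk[OF x that] by (simp add: a_def b_def c_def)
    \<comment> \<open>Distinct indices keep the three updates from overwriting one another.\<close>
    have "w a \<noteq> w b" "w b \<noteq> w c" "w a \<noteq> w c"
      using e by (auto simp: pullback_def card_insert_if split: if_splits)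
    then have "x ` {w a, w b, w c} = f ` {a, b, c}" by (auto simp: x_def)
    then show ?thesis using e by (simp add: pullback_def a_def b_def c_def)
  qed
  then show ?thesis
    using f A w unfolding contains_copy_def tight_cycle_def
    by (intro exI[of _ f]) auto
qed

text \<open>With \<open>s = 1 - \<epsilon>\<close> and \<open>q\<close> the expression bounded here,
  the Chernoff bound decays like \<open>(q / s) ^ m\<close>. The first-order terms of
  \<open>s - q\<close> cancel at density \<open>1 / 3\<close>, and the surplus density leaves the
  leading term \<open>2 * \<epsilon>\<^sup>2\<close>.\<close>

lemma sampling_constants:
  fixes \<epsilon> :: real
  assumes "0 < \<epsilon>" "\<epsilon> \<le> 1 / 3"
  shows "0 < 1 - (1 - (1 - \<epsilon>) ^ 3) * (1 / 3 + \<epsilon>)"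
    and "1 - (1 - (1 - \<epsilon>) ^ 3) * (1 / 3 + \<epsilon>) < 1 - \<epsilon>"
proof -
  have "0 < (1 - \<epsilon>) ^ 3" using assms by simp
  then have "(1 - (1 - \<epsilon>) ^ 3) * (1 / 3 + \<epsilon>) < 1 * 1"
    using assms by (intro mult_less_le_imp_less) (auto simp: power_le_one)
  then show "0 < 1 - (1 - (1 - \<epsilon>) ^ 3) * (1 / 3 + \<epsilon>)" by simp
  have "0 < \<epsilon> * \<epsilon> * (2 - 8 / 3 * \<epsilon> + \<epsilon>\<^sup>2)"
    using assms by (intro mult_pos_pos add_pos_nonneg) auto
  also have "\<dots> = (1 - \<epsilon>) - (1 - (1 - (1 - \<epsilon>) ^ 3) * (1 / 3 + \<epsilon>))"
    by (simp add: algebra_simps power2_eq_square power3_eq_cube)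
  finally show "1 - (1 - (1 - \<epsilon>) ^ 3) * (1 / 3 + \<epsilon>) < 1 - \<epsilon>" by simp
qed

theorem contains_tight_cycle:
  fixes \<epsilon> :: real
  assumes "0 < \<epsilon>" "\<epsilon> \<le> 1 / 3" and l: "l = 10 * a + 3 * b" "l > 0"
  shows "\<exists>n0. \<forall>H :: 'a hypergraph. wf_hypergraph H \<longrightarrow> n0 \<le> card (verts H) \<longrightarrow>
    (\<forall>u\<in>verts H. \<forall>v\<in>verts H. u \<noteq> v \<longrightarrow>
      (1 / 3 + \<epsilon>) * real (card (verts H)) \<le> real (codegree H {u, v})) \<longrightarrow>
    contains_copy H (tight_cycle l)"
proof -
  define s where "s = 1 - \<epsilon>"
  define q where "q = 1 - (1 - s ^ 3) * (1 / 3 + \<epsilon>)"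
  have s: "0 < s" "s \<le> 1" using assms by (auto simp: s_def)
  have q: "0 < q" "q < s"
    using sampling_constants[OF assms(1,2)] by (simp_all add: q_def s_def)
  \<comment> \<open>The union bound over at most \<open>m ^ 2\<close> pairs of indices is to cost at
    most \<open>1 / 4\<close>; the division by \<open>s\<^sup>2\<close> comes from
    \<open>s ^ m = s ^ k * s\<^sup>2\<close>.\<close>
  obtain k where k: "4 / s\<^sup>2 * (real k + 2)\<^sup>2 * (q / s) ^ k \<le> 1"
    using exists_sample_size[of "q / s" "4 / s\<^sup>2"] q s by auto
  define m where "m = k + 2"
  have q_small: "real m ^ 2 * (q ^ (m - 2) / s ^ m) \<le> 1 / 4"
    using k s by (simp add: m_def power_divide field_simps power2_eq_square)
  define I where "I = {..<m}"
  have I: "finite I" "card I = m" by (auto simp: I_def)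
  \<comment> \<open>At least half of the samples are good and there are \<open>m ^ l\<close> index
    sequences, so some sequence serves a proportion \<open>c\<close> of all samples.\<close>
  define c where "c = 1 / (2 * real m ^ l)"
  have "c > 0" by (simp add: c_def m_def)
  obtain n1 where n1: "\<forall>(V :: 'a set) R. finite V \<longrightarrow> n1 \<le> card V \<longrightarrow>
      R \<subseteq> PiE I (\<lambda>_. V) \<longrightarrow> c * real (card V) ^ card I \<le> real (card R) \<longrightarrow>
      (\<exists>A. (\<forall>i\<in>I. A i \<subseteq> V \<and> l \<le> card (A i)) \<and> PiE I A \<subseteq> R)"
    by (rule exE[OF dense_contains_box[OF I(1) \<open>c > 0\<close>]])
  have "contains_copy H (tight_cycle l)"
    if wf: "wf_hypergraph H" and large: "max n1 (4 * m ^ 2) \<le> card (verts H)"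
      and codeg: "\<And>u v. u \<in> verts H \<Longrightarrow> v \<in> verts H \<Longrightarrow> u \<noteq> v \<Longrightarrow>
        (1 / 3 + \<epsilon>) * real (card (verts H)) \<le> real (codegree H {u, v})"
    for H :: "'a hypergraph"
  proof -
    define V where "V = verts H"
    define n where "n = real (card V)"
    define P where "P = PiE I (\<lambda>_. V)"
    have V: "finite V" using wf by (simp add: wf_hypergraph_def V_def)
    have P: "finite P" "real (card P) = n ^ m"
      using V I by (auto simp: P_def n_def card_PiE intro!: finite_PiE)
    have "4 * m ^ 2 \<le> card V" using large by (simp add: V_def)
    then have "real (4 * m ^ 2) \<le> n" unfolding n_def by (rule of_nat_mono)
    then have n: "4 * real m ^ 2 \<le> n" by simp
    moreover have "0 < 4 * real m ^ 2" by (simp add: m_def)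
    ultimately have n0: "n > 0" by linarith
    define D where "D = {(i, j) \<in> I \<times> I. i \<noteq> j}"
    define Bad where
      "Bad = (\<lambda>(i, j). {x \<in> P. 3 * codegree (pullback I x H) {i, j} \<le> card I})"
    define Good where "Good = P - (\<Union>ij\<in>D. Bad ij)"
    have D: "finite D" "card D \<le> m ^ 2"
    proof -
      show "finite D" using I by (auto simp: D_def intro: finite_subset[of _ "I \<times> I"])
      have "card D \<le> card (I \<times> I)" using I by (intro card_mono) (auto simp: D_def)
      then show "card D \<le> m ^ 2" using I by (simp add: card_cartesian_product power2_eq_square)
    qed
    have Bad: "real (card (Bad ij)) \<le> n ^ m * (1 / n + q ^ (m - 2) / s ^ m)" if D_ij: "ij \<in> D" for ij
    proof -
      obtain i j where ij: "ij = (i, j)" "i \<in> I" "j \<in> I" "i \<noteq> j"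
        using D_ij by (auto simp: D_def)
      show ?thesis
        using card_bad_pair[OF wf I(1) ij(2-4) s, of "1 / 3 + \<epsilon>" n] codeg n0 assms I(2)
        by (simp add: ij(1) Bad_def P_def V_def n_def q_def)
    qed
    have "real (card (\<Union>ij\<in>D. Bad ij)) \<le> real (\<Sum>ij\<in>D. card (Bad ij))"
      using card_UN_le[OF D(1)] by (rule of_nat_mono)
    also have "\<dots> = (\<Sum>ij\<in>D. real (card (Bad ij)))" by simp
    also have "\<dots> \<le> (\<Sum>ij\<in>D. n ^ m * (1 / n + q ^ (m - 2) / s ^ m))"
      using Bad by (rule sum_mono)
    also have "\<dots> = real (card D) * (n ^ m * (1 / n + q ^ (m - 2) / s ^ m))" by simp
    also have "\<dots> \<le> real m ^ 2 * (n ^ m * (1 / n + q ^ (m - 2) / s ^ m))"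
      using D(2) n0 q s by (intro mult_right_mono) (auto simp flip: of_nat_power)
    also have "\<dots> = n ^ m * (real m ^ 2 / n + real m ^ 2 * (q ^ (m - 2) / s ^ m))"
      by (simp add: algebra_simps)
    \<comment> \<open>Coinciding values cost at most \<open>1 / 4\<close> because \<open>n\<close>
      is at least \<open>4 * m ^ 2\<close>, few hits another \<open>1 / 4\<close> by the choice of
      \<open>k\<close>.\<close>
    also have "\<dots> \<le> n ^ m * (1 / 4 + 1 / 4)"
      using n n0 q_small by (intro mult_left_mono add_mono) (auto simp: field_simps)
    finally have "real (card (\<Union>ij\<in>D. Bad ij)) \<le> n ^ m / 2" by simp
    moreover have "card P \<le> card Good + card (\<Union>ij\<in>D. Bad ij)"
    proof -
      have "finite (\<Union>ij\<in>D. Bad ij)" using P D by (auto simp: Bad_def)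
      then show ?thesis unfolding Good_def using diff_card_le_card_Diff[of _ P] by fastforce
    qed
    ultimately have Good: "n ^ m / 2 \<le> real (card Good)" using P(2) by linarith
    define W where "W = PiE {..<l} (\<lambda>_. I)"
    have W: "finite W" "card W = m ^ l"
      using I by (auto simp: W_def card_PiE intro!: finite_PiE)
    define R where "R = (\<lambda>w. {x \<in> P. \<forall>j<l.
      {w j, w ((j + 1) mod l), w ((j + 2) mod l)} \<in> edges (pullback I x H)})"
    have "Good \<subseteq> (\<Union>w\<in>W. R w)"
    proof
      fix x assume x: "x \<in> Good"
      let ?H = "pullback I x H"
      have ver: "verts ?H = I" by (simp add: pullback_def)
      have "card I < 3 * codegree ?H {i, j}" if "i \<in> I" "j \<in> I" "i \<noteq> j" for i j
        using x that by (force simp: Good_def D_def Bad_def)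
      then obtain p where "(p, p) \<in> tight_step ?H ^^ l"
        using closed_walk_exists[OF wf_pullback[OF I(1), of x H], unfolded ver, OF _ _ l(1)] I(2)
        by (metis le_add2 m_def)
      then obtain w where w: "\<And>j. j < l \<Longrightarrow>
          {w j, w ((j + 1) mod l), w ((j + 2) mod l)} \<in> edges ?H"
        by (rule closed_walk_cyclic) blast
      have "restrict w {..<l} \<in> W" using w by (auto simp: W_def pullback_def)
      moreover have "x \<in> R (restrict w {..<l})" using w x l(2) by (auto simp: R_def Good_def)
      ultimately show "x \<in> (\<Union>w\<in>W. R w)" by blast
    qed
    then have "card Good \<le> card (\<Union>w\<in>W. R w)"
      using P W by (intro card_mono) (auto simp: R_def)
    also have "\<dots> \<le> (\<Sum>w\<in>W. card (R w))" by (rule card_UN_le[OF W(1)])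
    finally have "n ^ m / 2 \<le> real (\<Sum>w\<in>W. card (R w))" using Good by linarith
    then have sum: "n ^ m / 2 \<le> (\<Sum>w\<in>W. real (card (R w)))" by simp
    have "\<exists>w\<in>W. c * n ^ m \<le> real (card (R w))"
    proof (rule ccontr)
      assume "\<not> ?thesis"
      moreover have "W \<noteq> {}" using W by (auto simp: m_def)
      ultimately have "(\<Sum>w\<in>W. real (card (R w))) < (\<Sum>w\<in>W. c * n ^ m)"
        using W by (intro sum_strict_mono) auto
      also have "\<dots> = n ^ m / 2" using W by (simp add: c_def m_def)
      finally show False using sum by simp
    qed
    then obtain w where w: "w \<in> W" "c * n ^ m \<le> real (card (R w))" by blast
    have "R w \<subseteq> PiE I (\<lambda>_. V)" by (auto simp: R_def P_def)
    then have "\<exists>A. (\<forall>i\<in>I. A i \<subseteq> V \<and> l \<le> card (A i)) \<and> PiE I A \<subseteq> R w"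
      using n1[rule_format, of V "R w"] V w(2) large I(2) by (simp add: n_def V_def)
    then obtain A where A: "\<forall>i\<in>I. A i \<subseteq> V \<and> l \<le> card (A i)" "PiE I A \<subseteq> R w"
      by blast
    show ?thesis
      by (rule contains_copy_of_box[of l w I A])
        (use A w(1) l(2) in \<open>auto simp: W_def R_def V_def\<close>)
  qed
  then show ?thesis by blast
qed

subsection \<open>The lower bound\<close>

text \<open>Residue 1 rather than 0 excludes triples of equal residues.\<close>

definition mod3_hypergraph :: "nat \<Rightarrow> nat hypergraph" where
  "mod3_hypergraph n =
     \<lparr>verts = {..<n}, edges = {e. e \<subseteq> {..<n} \<and> card e = 3 \<and> \<Sum>e mod 3 = 1}\<rparr>"

lemma wf_mod3_hypergraph: "wf_hypergraph (mod3_hypergraph n)"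
  by (auto simp: wf_hypergraph_def mod3_hypergraph_def)

lemma card_residue_class_ge:
  assumes "r < 3"
  shows "n div 3 \<le> card {w. w < n \<and> w mod 3 = r}"
proof -
  have "(\<lambda>i. 3 * i + r) ` {..<n div 3} \<subseteq> {w. w < n \<and> w mod 3 = r}"
    using assms by auto
  then have "card ((\<lambda>i. 3 * i + r) ` {..<n div 3}) \<le> card {w. w < n \<and> w mod 3 = r}"
    by (intro card_mono) auto
  then show ?thesis by (simp add: card_image inj_on_def)
qed

lemma codegree_mod3_hypergraph:
  assumes "u < n" "v < n" "u \<noteq> v"
  shows "n div 3 - 2 \<le> codegree (mod3_hypergraph n) {u, v}"
proof -
  \<comment> \<open>Modulo 3 this is \<open>1 - u - v\<close>, written without subtraction. The
    vertices \<open>u\<close> and \<open>v\<close> may lie in this class themselves, hence the loss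
    of 2.\<close>
  define r where "r = (1 + 2 * u + 2 * v) mod 3"
  have "n div 3 - 2 \<le> card {w. w < n \<and> w mod 3 = r} - card {u, v}"
    using card_residue_class_ge[of r n] assms by (simp add: r_def)
  also have "\<dots> \<le> card ({w. w < n \<and> w mod 3 = r} - {u, v})"
    by (rule diff_card_le_card_Diff) simp
  also have "\<dots> \<le> codegree (mod3_hypergraph n) {u, v}"
    unfolding codegree_def
  proof (intro card_mono subsetI)
    fix w assume w: "w \<in> {w. w < n \<and> w mod 3 = r} - {u, v}"
    then have "(w + (u + v)) mod 3 = (1 + 2 * u + 2 * v + (u + v)) mod 3"
      using mod_add_left_eq[of "1 + 2 * u + 2 * v" 3 "u + v"] mod_add_left_eq[of w 3 "u + v"]
      by (simp add: r_def)
    also have "\<dots> = 1" by presburger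
    finally show "w \<in> {w \<in> verts (mod3_hypergraph n). {w, u, v} \<in> edges (mod3_hypergraph n)}"
      using w assms by (auto simp: mod3_hypergraph_def)
  qed (simp add: mod3_hypergraph_def)
  finally show ?thesis .
qed

text \<open>Along a tight walk the residues modulo 3 have period 3, so they are constant on a closed
  walk of length prime to 3, and then every edge has sum \<open>0\<close> modulo 3.\<close>

lemma mod3_hypergraph_no_tight_cycle:
  assumes "\<not> 3 dvd l"
  shows "\<not> contains_copy (mod3_hypergraph n) (tight_cycle l)"
proof
  assume "contains_copy (mod3_hypergraph n) (tight_cycle l)"
  then obtain f where e: "\<And>e. e \<in> edges (tight_cycle l) \<Longrightarrow> f ` e \<in> edges (mod3_hypergraph n)"
    by (auto simp: contains_copy_def)
  have "l > 0" using assms by (cases l) auto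
  define F where "F = (\<lambda>i. f (i mod l) mod 3)"
  have edge: "(F i + F (Suc i) + F (Suc (Suc i))) mod 3 = 1" for i
  proof -
    define x y z where "x = f (i mod l)" and "y = f (Suc i mod l)" and "z = f (Suc (Suc i) mod l)"
    have "{i mod l, (i mod l + 1) mod l, (i mod l + 2) mod l} \<in> edges (tight_cycle l)"
      using \<open>l > 0\<close> by (simp add: tight_cycle_def)
    from e[OF this] have "{x, y, z} \<in> edges (mod3_hypergraph n)"
      using mod_add_left_eq[of i l 2] by (simp add: x_def y_def z_def mod_Suc_eq)
    then have "card {x, y, z} = 3" "\<Sum>{x, y, z} mod 3 = 1"
      by (auto simp: mod3_hypergraph_def)
    then have "(x + y + z) mod 3 = 1"
      by (auto simp: card_insert_if add.assoc split: if_splits)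
    moreover have "(x mod 3 + y mod 3 + z mod 3) mod 3 = ((x mod 3 + y mod 3) mod 3 + z) mod 3"
      by (rule trans[OF mod_add_right_eq mod_add_left_eq[symmetric]])
    moreover have "\<dots> = (x + y + z) mod 3"
      unfolding mod_add_eq by (rule mod_add_left_eq)
    ultimately have "(x mod 3 + y mod 3 + z mod 3) mod 3 = 1" by simp
    then show ?thesis by (simp only: F_def x_def y_def z_def)
  qed
  have F3: "F (i + 3) = F i" for i
  proof -
    have cancel: "a = b" if "a < 3" "b < 3" "(a + c) mod 3 = (b + c) mod 3" for a b c :: nat
    proof -
      \<comment> \<open>Adding \<open>2 * c\<close> on both sides turns \<open>c\<close> into a
        multiple of 3.\<close>
      have "(a + 3 * c) mod 3 = (b + 3 * c) mod 3"
        using mod_add_cong[OF that(3) refl[of "(2 * c) mod 3"]] by (simp add: algebra_simps)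
      then show ?thesis using that by simp
    qed
    have "F (Suc (Suc (Suc i))) = F i"
    proof (rule cancel)
      show "(F (Suc (Suc (Suc i))) + (F (Suc i) + F (Suc (Suc i)))) mod 3 =
          (F i + (F (Suc i) + F (Suc (Suc i)))) mod 3"
        using edge[of i] edge[of "Suc i"] by (simp only: ac_simps)
    qed (simp_all add: F_def)
    then show ?thesis by (simp only: add_Suc_right add_0_right numeral_3_eq_3)
  qed
  have per3: "F (i + 3 * k) = F i" for i k
  proof (induction k)
    case (Suc k)
    then show ?case using F3[of "i + 3 * k"] by (simp add: add.commute add.left_commute)
  qed simp
  have per: "F (i + l) = F i" for i by (simp add: F_def)
  \<comment> \<open>Up to multiples of 3, a shift by \<open>l\<close> is a shift by one forwards or
    backwards, so \<open>per\<close> and \<open>per3\<close> make \<open>F\<close> constant.\<close>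
  have "l = 3 * (l div 3) + 1 \<or> l + 1 = 3 * (l div 3 + 1)"
    using assms by presburger
  then consider "l = 3 * (l div 3) + 1" | "l + 1 = 3 * (l div 3 + 1)" by blast
  then have const: "F (Suc i) = F i" for i
  proof cases
    case 1
    then have "i + l = Suc i + 3 * (l div 3)" by linarith
    then show ?thesis using per[of i] per3[of "Suc i" "l div 3"] by (simp only:)
  next
    case 2
    then have "Suc i + l = i + 3 * (l div 3 + 1)" by linarith
    then show ?thesis using per[of "Suc i"] per3[of i "l div 3 + 1"] by (simp only:)
  qed
  have "F 0 + F (Suc 0) + F (Suc (Suc 0)) = 3 * F 0" using const[of 0] const[of "Suc 0"] by simp
  then have "(3 * F 0) mod 3 = 1" using edge[of 0] by (simp only:)
  then show False by simp
qed

section \<open>Minimum codegree and codegree Turan number as attained extrema\<close>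

lemma
  assumes "wf_hypergraph H" "card (verts H) = n" "n \<ge> 2"
  shows min_codegree_le_iff: "d \<le> min_codegree H \<longleftrightarrow>
      (\<forall>u\<in>verts H. \<forall>v\<in>verts H. u \<noteq> v \<longrightarrow> d \<le> codegree H {u, v})"
    and min_codegree_le_card: "min_codegree H \<le> n"
proof -
  let ?S = "{S. S \<subseteq> verts H \<and> card S = 2}"
  have fin: "finite (verts H)" using assms by (simp add: wf_hypergraph_def)
  \<comment> \<open>Two vertices make the set under \<open>Min\<close> nonempty, so the unspecified
    value does not arise.\<close>
  have "?S \<noteq> {}" using obtain_subset_with_card_n[of 2 "verts H"] assms by auto
  moreover have "finite ?S" using fin by simp
  ultimately have iff: "d \<le> min_codegree H \<longleftrightarrow> (\<forall>S\<in>?S. d \<le> codegree H S)" for d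
    unfolding min_codegree_def by (subst Min_ge_iff) auto
  show "d \<le> min_codegree H \<longleftrightarrow>
      (\<forall>u\<in>verts H. \<forall>v\<in>verts H. u \<noteq> v \<longrightarrow> d \<le> codegree H {u, v})"
  proof
    assume "d \<le> min_codegree H"
    then have "\<forall>S. S \<subseteq> verts H \<longrightarrow> card S = 2 \<longrightarrow> d \<le> codegree H S" by (simp add: iff)
    then show "\<forall>u\<in>verts H. \<forall>v\<in>verts H. u \<noteq> v \<longrightarrow> d \<le> codegree H {u, v}"
      by simp
  qed (auto simp: iff card_2_iff)
  obtain S where "S \<in> ?S" using \<open>?S \<noteq> {}\<close> by blast
  then have "min_codegree H \<le> codegree H S" using iff by blast
  also have "\<dots> \<le> card (verts H)" unfolding codegree_def using fin by (intro card_mono) auto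
  finally show "min_codegree H \<le> n" using assms by simp
qed

text \<open>The set under \<open>Max\<close> is bounded by \<open>n\<close>, and the
  \<open>F\<close>-free hypergraph \<open>H0\<close> puts 0 into it, so the maximum is
  attained.\<close>

lemma
  fixes H0 :: "nat hypergraph"
  assumes "n \<ge> 2" "wf_hypergraph H0" "card (verts H0) = n" "\<not> contains_copy H0 F"
  shows codegree_turan_number_ge: "d \<le> min_codegree H0 \<Longrightarrow> d \<le> codegree_turan_number n F"
    and codegree_turan_number_attained: "\<exists>H :: nat hypergraph. wf_hypergraph H \<and>
      card (verts H) = n \<and> \<not> contains_copy H F \<and> codegree_turan_number n F \<le> min_codegree H"
proof -
  let ?D = "{d. \<exists>H :: nat hypergraph. wf_hypergraph H \<and> card (verts H) = n \<and>
    \<not> contains_copy H F \<and> d \<le> min_codegree H}"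
  have "?D \<subseteq> {..n}" using min_codegree_le_card assms(1) by (auto intro: order_trans)
  then have fin: "finite ?D" by (rule finite_subset) simp
  show "d \<le> codegree_turan_number n F" if "d \<le> min_codegree H0"
    unfolding codegree_turan_number_def using assms that fin by (intro Max_ge) auto
  have "0 \<in> ?D" using assms by auto
  then have "codegree_turan_number n F \<in> ?D"
    unfolding codegree_turan_number_def using fin by (intro Max_in) auto
  then show "\<exists>H :: nat hypergraph. wf_hypergraph H \<and>
      card (verts H) = n \<and> \<not> contains_copy H F \<and> codegree_turan_number n F \<le> min_codegree H"
    by blast
qed

lemma mod3_le_codegree_turan_number:
  assumes "n \<ge> 2" "\<not> 3 dvd l"
  shows "n div 3 - 2 \<le> codegree_turan_number n (tight_cycle l)"
proof (rule codegree_turan_number_ge[OF assms(1) wf_mod3_hypergraph _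
      mod3_hypergraph_no_tight_cycle[OF assms(2)]])
  show card: "card (verts (mod3_hypergraph n)) = n" by (simp add: mod3_hypergraph_def)
  show "n div 3 - 2 \<le> min_codegree (mod3_hypergraph n)"
    unfolding min_codegree_le_iff[OF wf_mod3_hypergraph card assms(1)]
    using codegree_mod3_hypergraph by (simp add: mod3_hypergraph_def)
qed

subsection \<open>The limit\<close>

lemma codegree_turan_ratio_tendsto:
  assumes l: "l = 10 * a + 3 * b" "\<not> 3 dvd l"
  shows "codegree_turan_ratio (tight_cycle l) \<longlonglongrightarrow> 1 / 3"
proof (rule LIMSEQ_I)
  fix \<epsilon>' :: real
  assume "0 < \<epsilon>'"
  define \<epsilon> where "\<epsilon> = min \<epsilon>' (1 / 3)"
  have \<epsilon>: "0 < \<epsilon>" "\<epsilon> \<le> 1 / 3" "\<epsilon> \<le> \<epsilon>'" using \<open>0 < \<epsilon>'\<close> by (auto simp: \<epsilon>_def)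
  have "l > 0" using l(2) by (cases l) auto
  obtain n0 where n0: "\<forall>H :: nat hypergraph. wf_hypergraph H \<longrightarrow> n0 \<le> card (verts H) \<longrightarrow>
      (\<forall>u\<in>verts H. \<forall>v\<in>verts H. u \<noteq> v \<longrightarrow>
        (1 / 3 + \<epsilon>) * real (card (verts H)) \<le> real (codegree H {u, v})) \<longrightarrow>
      contains_copy H (tight_cycle l)"
    by (rule exE[OF contains_tight_cycle[OF \<epsilon>(1,2) l(1) \<open>l > 0\<close>]])
  \<comment> \<open>Beyond \<open>3 / \<epsilon>\<close> vertices the rounding loss of less than 3
    in \<open>n div 3 - 2\<close> stays below \<open>\<epsilon> * n\<close>.\<close>
  define N where "N = max (max n0 2) (nat \<lceil>3 / \<epsilon>\<rceil> + 1)"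
  have "norm (codegree_turan_ratio (tight_cycle l) n - 1 / 3) < \<epsilon>'" if "N \<le> n" for n
  proof -
    have n: "n0 \<le> n" "2 \<le> n" using that by (auto simp: N_def)
    have "3 / \<epsilon> < real n" using that unfolding N_def by linarith
    then have n\<epsilon>: "3 < \<epsilon> * real n" using \<epsilon> by (simp add: field_simps)
    define t where "t = codegree_turan_number n (tight_cycle l)"
    have lower: "n div 3 - 2 \<le> t"
      using mod3_le_codegree_turan_number[OF n(2) l(2)] by (simp add: t_def)
    have "\<exists>H :: nat hypergraph. wf_hypergraph H \<and> card (verts H) = n \<and>
        \<not> contains_copy H (tight_cycle l) \<and> t \<le> min_codegree H"
      unfolding t_def
      by (rule codegree_turan_number_attained[OF n(2) wf_mod3_hypergraph _
            mod3_hypergraph_no_tight_cycle[OF l(2)]]) (simp add: mod3_hypergraph_def)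
    then obtain H :: "nat hypergraph" where H: "wf_hypergraph H" "card (verts H) = n"
      "\<not> contains_copy H (tight_cycle l)" "t \<le> min_codegree H"
      by blast
    have upper: "real t < (1 / 3 + \<epsilon>) * real n"
    proof (rule ccontr)
      assume *: "\<not> ?thesis"
      have "(1 / 3 + \<epsilon>) * real (card (verts H)) \<le> real (codegree H {u, v})"
        if "u \<in> verts H" "v \<in> verts H" "u \<noteq> v" for u v
      proof -
        have "t \<le> codegree H {u, v}"
          using H(4) that unfolding min_codegree_le_iff[OF H(1,2) n(2)] by blast
        then show ?thesis using * H(2) by simp
      qed
      then show False using n0 H n by blast
    qed
    have "real n / 3 - 3 < real t" using lower by linarith
    then have "\<bar>real t - real n / 3\<bar> < \<epsilon> * real n"
      using upper n\<epsilon> by (simp add: abs_less_iff algebra_simps)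
    then have "\<bar>real t / real n - 1 / 3\<bar> < \<epsilon>"
      using n(2) by (simp add: abs_less_iff field_simps)
    then show ?thesis using \<epsilon> by (simp add: codegree_turan_ratio_def t_def)
  qed
  then show "\<exists>N. \<forall>n\<ge>N. norm (codegree_turan_ratio (tight_cycle l) n - 1 / 3) < \<epsilon>'" by blast
qed

theorem theorem1:
  fixes l :: nat
  assumes "l \<in> {10, 13, 16} \<or> (l \<ge> 19 \<and> \<not> 3 dvd l)"
  shows "convergent (codegree_turan_ratio (tight_cycle l)) \<and>
         codegree_turan_density (tight_cycle l) = 1 / 3"
proof -
  have "\<not> 3 dvd l" using assms by auto
  moreover have "\<exists>a b. l = 10 * a + 3 * b"
  \<comment> \<open>As 10 and 20 are 1 and 2 modulo 3, the two residues need
    \<open>l \<ge> 10\<close> and \<open>l \<ge> 20\<close>. The latter is where 11, 14 and 17 drop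
    out.\<close>
  proof (cases "l mod 3 = 1")
    case True
    then have "l = 10 * 1 + 3 * ((l - 10) div 3)" using assms by auto presburger
    then show ?thesis by blast
  next
    case False
    then have "l = 10 * 2 + 3 * ((l - 20) div 3)" using assms by auto presburger
    then show ?thesis by blast
  qed
  ultimately have "codegree_turan_ratio (tight_cycle l) \<longlonglongrightarrow> 1 / 3"
    using codegree_turan_ratio_tendsto by blast
  then show ?thesis
    by (simp add: codegree_turan_density_def convergentI limI)
qed

end
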